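(* (a) Let $q<0$ be real. The real solutions of $x^3+x+q=0$ are exactly the $x$-coordinates of the intersection points, other than the origin, of the parabola $y=x^2$ with the circle $\left(x+\frac q2\right)^2+y^2=\frac{q^2}{4}$ in $\mathbb{R}^2$. (b) Let $q'>0$ be real. The real solutions of $x^3-x+q'=0$ are exactly the $x$-coordinates of the intersection points, other than the origin, of the parabola $y=x^2$ with the hyperbola $\left(x-\frac{q'}2\right)^2-y^2=\frac{q'^2}{4}$ in $\mathbb{R}^2$. *)

theory Defs
  imports Complex_Main
begin

end

theory Submission
  imports Defs
begin

text \<open>Substituting \<open>y = x\<^sup>2\<close> into the equation of the circle (hyperbola) leaves \<open>x\<close> times the
  cubic, up to sign, and \<open>0\<close> is not a root of the cubic since \<open>q \<noteq> 0\<close>.\<close>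

text \<open>A point of the parabola is determined by its abscissa and is the origin exactly when
  that abscissa is 0.\<close>

lemma fst_image_parabola_Int_Diff_origin:
  fixes C :: "(real \<times> real) set"
  shows "fst ` ({(x, y). y = x\<^sup>2} \<inter> C - {(0, 0)}) = {x. x \<noteq> 0 \<and> (x, x\<^sup>2) \<in> C}"
  by force

lemma circle_on_parabola_iff:
  fixes x q :: real
  shows "(x + q / 2)\<^sup>2 + (x\<^sup>2)\<^sup>2 = q\<^sup>2 / 4 \<longleftrightarrow> x = 0 \<or> x ^ 3 + x + q = 0"
proof -
  have "(x + q / 2)\<^sup>2 + (x\<^sup>2)\<^sup>2 - q\<^sup>2 / 4 = x * (x ^ 3 + x + q)"
    by (simp add: field_simps power2_eq_square power3_eq_cube)
  then show ?thesis
    by (metis eq_iff_diff_eq_0 mult_eq_0_iff)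
qed

lemma hyperbola_on_parabola_iff:
  fixes x q :: real
  shows "(x - q / 2)\<^sup>2 - (x\<^sup>2)\<^sup>2 = q\<^sup>2 / 4 \<longleftrightarrow> x = 0 \<or> x ^ 3 - x + q = 0"
proof -
  \<comment> \<open>The difference is taken in this order because the left side of the hyperbola
    contributes \<open>- x ^ 4\<close>.\<close>
  have "q\<^sup>2 / 4 - ((x - q / 2)\<^sup>2 - (x\<^sup>2)\<^sup>2) = x * (x ^ 3 - x + q)"
    by (simp add: field_simps power2_eq_square power3_eq_cube)
  then show ?thesis
    by (metis eq_iff_diff_eq_0 mult_eq_0_iff)
qed

theorem mainTheorem9:
  shows "(\<forall>q::real. q < 0 \<longrightarrow>
           {x::real. x ^ 3 + x + q = 0} =
           fst ` ({(x::real, y::real). y = x\<^sup>2}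
                  \<inter> {(x, y). (x + q / 2)\<^sup>2 + y\<^sup>2 = q\<^sup>2 / 4} - {(0, 0)})) \<and>
         (\<forall>q'::real. q' > 0 \<longrightarrow>
           {x::real. x ^ 3 - x + q' = 0} =
           fst ` ({(x::real, y::real). y = x\<^sup>2}
                  \<inter> {(x, y). (x - q' / 2)\<^sup>2 - y\<^sup>2 = q'\<^sup>2 / 4} - {(0, 0)}))"
  unfolding fst_image_parabola_Int_Diff_origin mem_Collect_eq prod.case
    circle_on_parabola_iff hyperbola_on_parabola_iff
  \<comment> \<open>The right-hand sides are now the \<open>x \<noteq> 0\<close> with
    \<open>x = 0\<close> or cubic zero. At \<open>x = 0\<close> the cubics take the values
    \<open>q\<close> and \<open>q'\<close>, nonzero by the sign hypotheses.\<close>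
  by auto

end
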